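(* Let $\mathbb{F}$ be a field whose characteristic is not $2$, let $R=\mathrm{Mat}_2(\mathbb{F})$, let $k\geq 1$ and $n=2k$, and let $f:R^k\to R^k$ be an arbitrary homomorphism of left $R$-modules. Let $A\in\mathrm{Mat}_n(\mathbb{F})$ be the matrix corresponding to $f$, and let $\{p_1(T),\ldots,p_m(T)\}$ be the set of all (distinct) monic quadratic irreducible factors in $\mathbb{F}[T]$ of the characteristic polynomial $p_A(T)$ of $A$. Write $p_i(T)=T^2+\lambda_iT+\mu_i$ for $1\leq i\leq m$. Then the matrices $$\Lambda_i=\begin{bmatrix} -\lambda_i& 1\\ -\mu_i& 0\end{bmatrix},\qquad 1\leq i\leq m,$$ are all the pairwise non-similar proper eigenvalues of $f$; that is, each $\Lambda_i$ is a proper eigenvalue of $f$, the $\Lambda_i$ are pairwise non-similar, and every proper eigenvalue of $f$ is similar to one of the $\Lambda_i$.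
   Context: Let $\mathbb{F}$ be a field, $R=\mathrm{Mat}_2(\mathbb{F})$, $n=2k$. Let $\mathcal{U}=\mathbb{F}^n\oplus\mathbb{F}^n$, with elements written $\begin{bmatrix}\mathbf{u}\\ \mathbf{v}\end{bmatrix}$ ($\mathbf{u},\mathbf{v}\in\mathbb{F}^n$), be the left $R$-module with action $\begin{bmatrix} p&q\\ r&s\end{bmatrix}\cdot\begin{bmatrix}\mathbf{u}\\ \mathbf{v}\end{bmatrix}=\begin{bmatrix}p\mathbf{u}+q\mathbf{v}\\ r\mathbf{u}+s\mathbf{v}\end{bmatrix}$. With $e_1,\dots,e_n$ the standard basis of $\mathbb{F}^n$, the elements $T_i=\begin{bmatrix}e_i\\ e_{k+i}\end{bmatrix}$, $1\leq i\leq k$, form an $R$-basis of $\mathcal{U}$, so $\Phi:R^k\to\mathcal{U}$, $(M_1,\dots,M_k)\mapsto\sum_i M_i\cdot T_i$, is an isomorphism of $R$-modules. Every $R$-endomorphism of $\mathcal{U}$ has the form $f_A:\begin{bmatrix}\mathbf{u}\\ \mathbf{v}\end{bmatrix}\mapsto\begin{bmatrix}A\mathbf{u}\\ A\mathbf{v}\end{bmatrix}$ for a unique $A\in\mathrm{Mat}_n(\mathbb{F})$. The matrix corresponding to an $R$-homomorphism $f:R^k\to R^k$ is the matrix $A$ with $\Phi\circ f\circ\Phi^{-1}=f_A$. A super-eigenvector of $A$ is a $2$-dimensional $A$-invariant subspace $W\subseteq\mathbb{F}^n$. It is proper if it contains no eigenvector of $A$. If $W=\langle\mathbf{u},\mathbf{v}\rangle$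 is a super-eigenvector with basis $\mathbf{u},\mathbf{v}$ and $A\mathbf{u}=p\mathbf{u}+q\mathbf{v}$, $A\mathbf{v}=r\mathbf{u}+s\mathbf{v}$ (equivalently $f_A\begin{bmatrix}\mathbf{u}\\ \mathbf{v}\end{bmatrix}=\Lambda\cdot\begin{bmatrix}\mathbf{u}\\ \mathbf{v}\end{bmatrix}$ with $\Lambda=\begin{bmatrix} p&q\\ r&s\end{bmatrix}$), then $\Lambda$ is a super-eigenvalue of $A$ corresponding to $W$. It is called proper if it corresponds to a proper super-eigenvector. A matrix $\Lambda\in R$ is a proper eigenvalue of $f$ if it is a proper super-eigenvalue of the matrix $A$ corresponding to $f$. Similarity of $2\times2$ matrices means conjugacy under $\mathrm{GL}_2(\mathbb{F})$. *)

theory Defs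
  imports
    "Jordan_Normal_Form.Char_Poly"
    "Jordan_Normal_Form.VS_Connect"
    "HOL-Library.FuncSet"
begin

section \<open>The free left module over the 2 by 2 matrices\<close>

text \<open>Elements of \<open>R\<^sup>k\<close> are families of 2 by 2 matrices indexed by \<open>{..<k}\<close>, extended by
  \<open>undefined\<close> so that equality of functions is equality of tuples. All indices run from 0.\<close>

definition R_pow :: "nat \<Rightarrow> (nat \<Rightarrow> 'a::field mat) set" where
  "R_pow k = {..<k} \<rightarrow>\<^sub>E carrier_mat 2 2"

definition R_pow_add ::
  "nat \<Rightarrow> (nat \<Rightarrow> 'a::field mat) \<Rightarrow> (nat \<Rightarrow> 'a mat) \<Rightarrow> (nat \<Rightarrow> 'a mat)" where
  "R_pow_add k x y = (\<lambda>i\<in>{..<k}. x i + y i)"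

definition R_pow_smult ::
  "nat \<Rightarrow> 'a::field mat \<Rightarrow> (nat \<Rightarrow> 'a mat) \<Rightarrow> (nat \<Rightarrow> 'a mat)" where
  "R_pow_smult k M x = (\<lambda>i\<in>{..<k}. M * x i)"

definition R_pow_hom :: "nat \<Rightarrow> ((nat \<Rightarrow> 'a::field mat) \<Rightarrow> (nat \<Rightarrow> 'a mat)) set" where
  "R_pow_hom k = {f \<in> R_pow k \<rightarrow> R_pow k.
     (\<forall>x\<in>R_pow k. \<forall>y\<in>R_pow k. f (R_pow_add k x y) = R_pow_add k (f x) (f y)) \<and>
     (\<forall>M\<in>carrier_mat 2 2. \<forall>x\<in>R_pow k. f (R_pow_smult k M x) = R_pow_smult k M (f x))}"


section \<open>The module of pairs of vectors\<close>

definition U_carrier :: "nat \<Rightarrow> ('a::field vec \<times> 'a vec) set" where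
  "U_carrier k = carrier_vec (2 * k) \<times> carrier_vec (2 * k)"

definition U_act :: "'a::field mat \<Rightarrow> 'a vec \<times> 'a vec \<Rightarrow> 'a vec \<times> 'a vec" where
  "U_act M w = (M $$ (0,0) \<cdot>\<^sub>v fst w + M $$ (0,1) \<cdot>\<^sub>v snd w,
                M $$ (1,0) \<cdot>\<^sub>v fst w + M $$ (1,1) \<cdot>\<^sub>v snd w)"

definition U_basis :: "nat \<Rightarrow> nat \<Rightarrow> 'a::field vec \<times> 'a vec" where
  "U_basis k i = (unit_vec (2 * k) i, unit_vec (2 * k) (k + i))"

definition Phi :: "nat \<Rightarrow> (nat \<Rightarrow> 'a::field mat) \<Rightarrow> 'a vec \<times> 'a vec" where
  "Phi k x =
     (finsum_vec TYPE('a) (2 * k) (\<lambda>i. fst (U_act (x i) (U_basis k i))) {..<k},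
      finsum_vec TYPE('a) (2 * k) (\<lambda>i. snd (U_act (x i) (U_basis k i))) {..<k})"

definition U_endo :: "'a::field mat \<Rightarrow> 'a vec \<times> 'a vec \<Rightarrow> 'a vec \<times> 'a vec" where
  "U_endo A w = (A *\<^sub>v fst w, A *\<^sub>v snd w)"

definition corresponds_to ::
  "nat \<Rightarrow> ((nat \<Rightarrow> 'a::field mat) \<Rightarrow> (nat \<Rightarrow> 'a mat)) \<Rightarrow> 'a mat \<Rightarrow> bool" where
  "corresponds_to k f A \<longleftrightarrow> A \<in> carrier_mat (2 * k) (2 * k) \<and>
     (\<forall>w\<in>U_carrier k. Phi k (f (inv_into (R_pow k) (Phi k) w)) = U_endo A w)"

text \<open>\<open>Phi k\<close> is a bijection from \<open>R_pow k\<close> onto \<open>U_carrier k\<close> and every endomorphism of the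
  module of pairs is \<open>U_endo A\<close> for a unique \<open>A\<close>, so the description below is definite
  whenever \<open>f \<in> R_pow_hom k\<close>.\<close>

definition hom_mat ::
  "nat \<Rightarrow> ((nat \<Rightarrow> 'a::field mat) \<Rightarrow> (nat \<Rightarrow> 'a mat)) \<Rightarrow> 'a mat" where
  "hom_mat k f = (THE A. corresponds_to k f A)"


section \<open>Super-eigenvectors and proper eigenvalues\<close>

abbreviation sub_vs :: "nat \<Rightarrow> 'a::field vec set \<Rightarrow> ('a, 'a vec) module" where
  "sub_vs n W \<equiv> (module_vec TYPE('a) n)\<lparr>carrier := W\<rparr>"

definition super_eigenvector :: "'a::field mat \<Rightarrow> 'a vec set \<Rightarrow> bool" where
  "super_eigenvector A W \<longleftrightarrow>
     subspace class_ring W (module_vec TYPE('a) (dim_row A)) \<and>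
     vectorspace.dim class_ring (sub_vs (dim_row A) W) = 2 \<and>
     (\<forall>w\<in>W. A *\<^sub>v w \<in> W)"

definition proper_super_eigenvector :: "'a::field mat \<Rightarrow> 'a vec set \<Rightarrow> bool" where
  "proper_super_eigenvector A W \<longleftrightarrow>
     super_eigenvector A W \<and> \<not> (\<exists>w\<in>W. \<exists>c. eigenvector A w c)"

definition super_eigenvalue_of :: "'a::field mat \<Rightarrow> 'a vec set \<Rightarrow> 'a mat \<Rightarrow> bool" where
  "super_eigenvalue_of A W L \<longleftrightarrow>
     super_eigenvector A W \<and> L \<in> carrier_mat 2 2 \<and>
     (\<exists>u v. u \<noteq> v \<and> vectorspace.basis class_ring (sub_vs (dim_row A) W) {u, v} \<and>
        A *\<^sub>v u = L $$ (0,0) \<cdot>\<^sub>v u + L $$ (0,1) \<cdot>\<^sub>v v \<and>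
        A *\<^sub>v v = L $$ (1,0) \<cdot>\<^sub>v u + L $$ (1,1) \<cdot>\<^sub>v v)"

definition proper_super_eigenvalue :: "'a::field mat \<Rightarrow> 'a mat \<Rightarrow> bool" where
  "proper_super_eigenvalue A L \<longleftrightarrow>
     (\<exists>W. proper_super_eigenvector A W \<and> super_eigenvalue_of A W L)"

definition proper_eigenvalue ::
  "nat \<Rightarrow> ((nat \<Rightarrow> 'a::field mat) \<Rightarrow> (nat \<Rightarrow> 'a mat)) \<Rightarrow> 'a mat \<Rightarrow> bool" where
  "proper_eigenvalue k f L \<longleftrightarrow> proper_super_eigenvalue (hom_mat k f) L"

end

theory Submission
  imports Defs
begin

text \<open>Let \<open>q = T\<^sup>2 + l T + m\<close> be irreducible. If \<open>q\<close> divides \<open>char_poly A\<close>, then \<open>q(A)\<close> is singular; for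
  \<open>u \<noteq> 0\<close> with \<open>q(A) u = 0\<close>, the vectors \<open>u\<close> and \<open>v = A u + l u\<close> span an invariant plane without
  eigenvectors (\<open>q\<close> has no root) on which \<open>A\<close> acts by the companion matrix \<open>\<Lambda>\<close> of \<open>q\<close>. Conversely, on
  a proper super-eigenvector \<open>A\<close> acts by some \<open>L\<close> whose characteristic polynomial \<open>q\<close> has no root, so
  it is irreducible, it divides \<open>char_poly A\<close> because \<open>q(A)\<close> has a kernel, and the upper right entry of
  \<open>L\<close> is nonzero, which makes \<open>L\<close> similar to \<open>\<Lambda>\<close>.\<close>

section \<open>Planes spanned by two vectors\<close>

lemma (in vec_space) lincomb_pair:
  assumes "u \<in> carrier_vec n" "v \<in> carrier_vec n" "u \<noteq> v"
  shows "lincomb a {u, v} = a u \<cdot>\<^sub>v u + a v \<cdot>\<^sub>v v"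
  using assms unfolding lincomb_def by (subst finsum_insert) auto

text \<open>Independence is phrased through coefficients rather than for the set
  \<open>{u, v}\<close>. It therefore also excludes \<open>u = v\<close>, so the set really has two
  elements and the dimension is 2.\<close>

lemma (in vec_space) pair_basisI:
  assumes u: "u \<in> carrier_vec n" and v: "v \<in> carrier_vec n"
    and indep: "\<And>a b. a \<cdot>\<^sub>v u + b \<cdot>\<^sub>v v = 0\<^sub>v n \<Longrightarrow> a = 0 \<and> b = 0"
  shows "u \<noteq> v" "subspace class_ring (span {u, v}) V"
    "vectorspace.basis class_ring (vs (span {u, v})) {u, v}"
    "vectorspace.dim class_ring (vs (span {u, v})) = 2"
proof -
  show ne: "u \<noteq> v"
  proof
    assume "u = v"
    moreover have "v + (- 1) \<cdot>\<^sub>v v = 0\<^sub>v n"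
      using v by (intro eq_vecI) auto
    ultimately show False
      using indep[of 1 "- 1"] by simp
  qed
  show sub: "subspace class_ring (span {u, v}) V"
    using u v by (intro span_is_subspace) auto
  interpret W: vectorspace class_ring "vs (span {u, v})"
    using sub by (rule subspace_is_vs)
  have in_span: "{u, v} \<subseteq> span {u, v}"
    using u v by (intro in_own_span) auto
  have "lin_indpt {u, v}"
    using u v lincomb_pair[OF u v ne] indep by (intro finite_lin_indpt2) auto
  \<comment> \<open>Independence and span mean the same inside a submodule as in the ambient
    space.\<close>
  then show basis: "W.basis {u, v}"
    unfolding W.basis_def using span_li_not_depend[OF in_span is_module[OF sub]] in_span by auto
  show "W.dim = 2"
    using W.dim_basis[OF _ basis] ne by simp
qed

lemma (in vec_space) span_pair:
  assumes u: "u \<in> carrier_vec n" and v: "v \<in> carrier_vec n" and ne: "u \<noteq> v"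
    and w: "w \<in> span {u, v}"
  obtains a b where "w = a \<cdot>\<^sub>v u + b \<cdot>\<^sub>v v"
proof -
  obtain a where "w = lincomb a {u, v}"
    using w finite_span[of "{u, v}"] u v by auto
  then show ?thesis
    using that lincomb_pair[OF u v ne] by auto
qed

lemma (in vec_space) pair_basisD:
  assumes sub: "subspace class_ring W V" and ne: "u \<noteq> v"
    and basis: "vectorspace.basis class_ring (vs W) {u, v}"
  shows "u \<in> W" "v \<in> W" "W \<subseteq> carrier_vec n"
    "a \<cdot>\<^sub>v u + b \<cdot>\<^sub>v v \<in> W"
    "a \<cdot>\<^sub>v u + b \<cdot>\<^sub>v v = 0\<^sub>v n \<Longrightarrow> a = 0 \<and> b = 0"
proof -
  interpret W: vectorspace class_ring "vs W"
    using sub by (rule subspace_is_vs)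
  have subW: "submodule class_ring W V"
    using sub by (rule is_module)
  show uW: "u \<in> W" and vW: "v \<in> W"
    using basis unfolding W.basis_def by auto
  show WV: "W \<subseteq> carrier_vec n"
    using submodule.subset[OF subW] by auto
  show "a \<cdot>\<^sub>v u + b \<cdot>\<^sub>v v \<in> W"
    using submodule.m_closed[OF subW] submodule.smult_closed[OF subW] uW vW by auto
  assume eq: "a \<cdot>\<^sub>v u + b \<cdot>\<^sub>v v = 0\<^sub>v n"
  have indpt: "lin_indpt {u, v}"
    using basis span_li_not_depend[OF _ subW, of "{u, v}"] uW vW unfolding W.basis_def by auto
  have u: "u \<in> carrier_vec n" and v: "v \<in> carrier_vec n"
    using uW vW WV by auto
  \<comment> \<open>As \<open>u\<close> and \<open>v\<close> differ, a single coefficient function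
    on \<open>{u, v}\<close> can carry both \<open>a\<close> and \<open>b\<close>.\<close>
  have "lincomb (\<lambda>x. if x = u then a else b) {u, v} = 0\<^sub>v n"
    using lincomb_pair[OF u v ne] ne eq by auto
  then show "a = 0 \<and> b = 0"
    using indpt ne lin_dep_crit[where A = "{u, v}" and S = "{u, v}" and a = "\<lambda>x. if x = u then a else b" and v = u]
      lin_dep_crit[where A = "{u, v}" and S = "{u, v}" and a = "\<lambda>x. if x = u then a else b" and v = v]
    by auto
qed

section \<open>Quadratic factors of the characteristic polynomial\<close>

lemma zero_smult_vec [simp]: "v \<in> carrier_vec n \<Longrightarrow> (0 :: 'a::semiring_0) \<cdot>\<^sub>v v = 0\<^sub>v n"
  by (intro eq_vecI) auto

lemma smult_mat_mult_vec:
  assumes "v \<in> carrier_vec (dim_col A)"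
  shows "(c \<cdot>\<^sub>m A) *\<^sub>v v = c \<cdot>\<^sub>v (A *\<^sub>v v)"
  using assms by (intro eq_vecI) (auto simp: scalar_prod_def sum_distrib_left mult.assoc)

lemma mult_mat_smult_vec:
  fixes c :: "'a::comm_semiring_0"
  assumes "v \<in> carrier_vec (dim_col A)"
  shows "A *\<^sub>v (c \<cdot>\<^sub>v v) = c \<cdot>\<^sub>v (A *\<^sub>v v)"
  using assms by (intro eq_vecI) (auto simp: scalar_prod_def sum_distrib_left ac_simps)

text \<open>The degrees of two factors add up to 2, so a proper factorization has linear factors,
  and over a field a linear polynomial has a root.\<close>

lemma irreducible_monic_quadratic_iff:
  fixes l m :: "'a::field"
  shows "irreducible [:m, l, 1:] \<longleftrightarrow> (\<forall>c. poly [:m, l, 1:] c \<noteq> 0)"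
proof
  assume irr: "irreducible [:m, l, 1:]"
  show "\<forall>c. poly [:m, l, 1:] c \<noteq> 0"
  proof (intro allI notI)
    fix c assume "poly [:m, l, 1:] c = 0"
    then obtain r where r: "[:m, l, 1:] = [:- c, 1:] * r"
      unfolding poly_eq_0_iff_dvd by (rule dvdE)
    then have "r \<noteq> 0" by auto
    then have "degree r = 1"
      using arg_cong[OF r, of degree] by (simp add: degree_mult_eq del: mult_pCons_left)
    moreover have "is_unit [:- c, 1:] \<or> is_unit r"
      using irreducibleD[OF irr r] .
    ultimately show False
      using \<open>r \<noteq> 0\<close> by (simp add: is_unit_iff_degree)
  qed
next
  assume noroot: "\<forall>c. poly [:m, l, 1:] c \<noteq> 0"
  have no_linear: "degree a \<noteq> 1" if "a dvd [:m, l, 1:]" for a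
  proof
    assume "degree a = 1"
    then obtain x y where a: "a = [:x, y:]" "y \<noteq> 0"
      by (metis degree1_coeffs)
    then have "poly a (- x / y) = 0" by simp
    then show False
      using that noroot by (metis dvdE mult_zero_left poly_mult)
  qed
  show "irreducible [:m, l, 1:]"
  proof (rule irreducibleI)
    fix a b assume ab: "[:m, l, 1:] = a * b"
    then have nz: "a \<noteq> 0" "b \<noteq> 0" by auto
    then have "degree a + degree b = 2"
      using arg_cong[OF ab, of degree] by (simp add: degree_mult_eq)
    moreover have "degree a \<noteq> 1" "degree b \<noteq> 1"
      using no_linear ab by auto
    ultimately have "degree a = 0 \<or> degree b = 0" by arith
    then show "is_unit a \<or> is_unit b"
      using nz by (auto simp: is_unit_iff_degree)
  qed (auto simp: is_unit_pCons_iff)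
qed

text \<open>The factorization \<open>q(T) - q(A) = (T - A) (T + l + A)\<close> shows that \<open>char_poly (q(A))\<close>
  evaluated at \<open>q(T)\<close> is a multiple of \<open>char_poly A\<close>, hence of \<open>q\<close>. Its constant term,
  a sign times the determinant of \<open>q(A)\<close>, is then a constant divisible by \<open>q\<close>.\<close>

lemma quadratic_dvd_char_poly_imp_kernel:
  fixes A :: "'a::field mat"
  assumes A: "A \<in> carrier_mat n n" and dvd: "[:m, l, 1:] dvd char_poly A"
  obtains u where "u \<in> carrier_vec n" "u \<noteq> 0\<^sub>v n"
    "A *\<^sub>v (A *\<^sub>v u) + l \<cdot>\<^sub>v (A *\<^sub>v u) + m \<cdot>\<^sub>v u = 0\<^sub>v n"
proof -
  let ?q = "[:m, l, 1:]"
  \<comment> \<open>\<open>N\<close> is \<open>q(A)\<close>, and \<open>B\<close> is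
    \<open>T + l + A\<close> as a matrix of polynomials.\<close>
  define N where "N = A * A + l \<cdot>\<^sub>m A + m \<cdot>\<^sub>m 1\<^sub>m n"
  define B where "B = mat n n (\<lambda>(i, j). (if i = j then [:l, 1:] else 0) + [:A $$ (i, j):])"
  have N: "N \<in> carrier_mat n n" and B: "B \<in> carrier_mat n n"
    using A by (auto simp: N_def B_def)
  have mul: "map_mat (\<lambda>p. pcompose p ?q) (char_poly_matrix N) = char_poly_matrix A * B"
  proof (rule eq_matI)
    fix i j assume "i < dim_row (char_poly_matrix A * B)" "j < dim_col (char_poly_matrix A * B)"
    then have i: "i < n" and j: "j < n"
      using A B by (auto simp: char_poly_matrix_def)
    have sum_const: "(\<Sum>x\<in>S. [:g x:]) = [:\<Sum>x\<in>S. g x:]" for g :: "nat \<Rightarrow> 'a" and S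
      by (induction S rule: infinite_finite_induct) auto
    have "(char_poly_matrix A * B) $$ (i, j) =
      (\<Sum>k = 0..<n. ((if i = k then [:0, 1:] else 0) + [:- A $$ (i, k):]) *
         ((if k = j then [:l, 1:] else 0) + [:A $$ (k, j):]))"
      using i j A by (auto simp: char_poly_matrix_def B_def scalar_prod_def intro!: sum.cong)
    \<comment> \<open>Two summands carry a Kronecker delta and collapse to one index; the third adds
      up to the entries of \<open>- A * A\<close>.\<close>
    also have "\<dots> = (\<Sum>k = 0..<n. (if i = k then [:0, 1:] * ((if k = j then [:l, 1:] else 0) + [:A $$ (k, j):]) else 0)
        + (if k = j then [:- A $$ (i, k):] * [:l, 1:] else 0) + [:- (A $$ (i, k) * A $$ (k, j)):])"
      by (intro sum.cong refl) (auto simp: algebra_simps)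
    also have "\<dots> = [:0, 1:] * ((if i = j then [:l, 1:] else 0) + [:A $$ (i, j):])
        + [:- A $$ (i, j):] * [:l, 1:] + [:- (\<Sum>k = 0..<n. A $$ (i, k) * A $$ (k, j)):]"
      using i j by (simp add: sum.distrib sum_const sum_negf)
    also have "\<dots> = map_mat (\<lambda>p. pcompose p ?q) (char_poly_matrix N) $$ (i, j)"
      using i j A by (auto simp: char_poly_matrix_def N_def scalar_prod_def pcompose_add pcompose_pCons
          algebra_simps)
    finally show "map_mat (\<lambda>p. pcompose p ?q) (char_poly_matrix N) $$ (i, j) = (char_poly_matrix A * B) $$ (i, j)"
      by simp
  qed (use A B N in \<open>auto simp: char_poly_matrix_def\<close>)
  have "pcompose (char_poly N) ?q = char_poly A * det B"
    unfolding char_poly_def comm_ring_hom.hom_det[OF pcompose_hom.comm_ring_hom_axioms, symmetric] mul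
    using A B by (intro det_mult) auto
  then have "?q dvd pcompose (char_poly N) ?q"
    using dvd by auto
  \<comment> \<open>Substituting \<open>q\<close> for \<open>T\<close> in \<open>c + T r(T)\<close>
    leaves \<open>c\<close> modulo \<open>q\<close>, and by degree the only constant divisible by
    \<open>q\<close> is 0.\<close>
  moreover obtain c r where cr: "char_poly N = pCons c r"
    by (rule pCons_cases)
  ultimately have "?q dvd [:c:]"
    by (simp add: pcompose_pCons dvd_add_left_iff del: mult_pCons_left)
  then have "c = 0"
    by (metis (no_types, lifting) degree_pCons_0 degree_pCons_eq_if dvd_imp_degree_le
        le_zero_eq nat.distinct(1) one_neq_zero pCons_eq_0_iff)
  \<comment> \<open>\<open>c\<close> is the value of \<open>char_poly N\<close> at 0; an eigenvector
    for 0 is the kernel vector sought.\<close>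
  then have "eigenvalue N 0"
    using cr eigenvalue_root_char_poly[OF N] by simp
  then obtain u where u: "u \<in> carrier_vec n" "u \<noteq> 0\<^sub>v n" "N *\<^sub>v u = 0\<^sub>v n"
    using N unfolding eigenvalue_def eigenvector_def by auto
  have "N *\<^sub>v u = A *\<^sub>v (A *\<^sub>v u) + l \<cdot>\<^sub>v (A *\<^sub>v u) + m \<cdot>\<^sub>v u"
    using A u unfolding N_def
    by (simp add: add_mult_distrib_mat_vec[of _ n n] assoc_mult_mat_vec[of _ n n _ n] smult_mat_mult_vec)
  then show ?thesis
    using that u by auto
qed

text \<open>If \<open>q(A) u = 0\<close>, then \<open>w = (T + l) u + A u\<close> satisfies \<open>(T - A) w = q u\<close>; multiplying by the
  adjugate of \<open>T - A\<close> shows that \<open>q\<close> divides every entry of \<open>char_poly A \<cdot> w\<close>.\<close>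

lemma irreducible_quadratic_kernel_imp_dvd_char_poly:
  fixes A :: "'a::field mat"
  assumes A: "A \<in> carrier_mat n n" and u: "u \<in> carrier_vec n" "u \<noteq> 0\<^sub>v n"
    and ker: "A *\<^sub>v (A *\<^sub>v u) + l \<cdot>\<^sub>v (A *\<^sub>v u) + m \<cdot>\<^sub>v u = 0\<^sub>v n"
    and irr: "irreducible [:m, l, 1:]"
  shows "[:m, l, 1:] dvd char_poly A"
proof -
  let ?q = "[:m, l, 1:]" and ?M = "char_poly_matrix A"
  define y where "y = A *\<^sub>v u"
  define w where "w = vec n (\<lambda>i. [:l * u $ i + y $ i, u $ i:])"
  define w' where "w' = map_vec (\<lambda>c. [:c:]) u"
  have y: "y \<in> carrier_vec n"
    using A u by (simp add: y_def)
  have M: "?M \<in> carrier_mat n n" and w: "w \<in> carrier_vec n" and w': "w' \<in> carrier_vec n"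
    using A u by (auto simp: w_def w'_def)
  have Mw: "?M *\<^sub>v w = ?q \<cdot>\<^sub>v w'"
  proof (rule eq_vecI)
    fix i assume "i < dim_vec (?q \<cdot>\<^sub>v w')"
    then have i: "i < n" using w' by auto
    have sum_lin: "(\<Sum>x\<in>S. [:g x, h x:]) = [:\<Sum>x\<in>S. g x, \<Sum>x\<in>S. h x:]" for g h :: "nat \<Rightarrow> 'a" and S
      by (induction S rule: infinite_finite_induct) auto
    have sum_y: "(\<Sum>k = 0..<n. A $$ (i, k) * u $ k) = y $ i"
      and sum_Ay: "(\<Sum>k = 0..<n. A $$ (i, k) * y $ k) = (A *\<^sub>v y) $ i"
      using i A u y by (auto simp: y_def scalar_prod_def)
    have "(?M *\<^sub>v w) $ i = (\<Sum>k = 0..<n. ((if i = k then [:0, 1:] else 0) + [:- A $$ (i, k):]) *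
         [:l * u $ k + y $ k, u $ k:])"
      using i A by (auto simp: char_poly_matrix_def w_def scalar_prod_def simp del: mult_pCons_right
          intro!: sum.cong)
    also have "\<dots> = (\<Sum>k = 0..<n. (if i = k then [:0, 1:] * [:l * u $ k + y $ k, u $ k:] else 0)
        + [:- (l * (A $$ (i, k) * u $ k) + A $$ (i, k) * y $ k), - (A $$ (i, k) * u $ k):])"
      by (intro sum.cong refl) (auto simp: algebra_simps)
    also have "\<dots> = [:0, 1:] * [:l * u $ i + y $ i, u $ i:]
        + [:- (l * y $ i + (A *\<^sub>v y) $ i), - y $ i:]"
      using i sum_y sum_Ay
      by (simp add: sum.distrib sum_lin sum_negf sum_subtractf flip: sum_distrib_left)
    \<comment> \<open>The kernel relation turns the constant coefficient, an entry of
      \<open>- (l A u + A A u)\<close>, into that of \<open>m u\<close>.\<close>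
    also have "\<dots> = (?q \<cdot>\<^sub>v w') $ i"
      using arg_cong[OF ker, of "\<lambda>x. x $ i"] i A u y
      by (simp add: w'_def y_def[symmetric] algebra_simps neg_eq_iff_add_eq_0)
    finally show "(?M *\<^sub>v w) $ i = (?q \<cdot>\<^sub>v w') $ i" .
  qed (use M w' in auto)
  have "adj_mat ?M *\<^sub>v (?M *\<^sub>v w) = char_poly A \<cdot>\<^sub>v w"
    using adj_mat[OF M] w M unfolding char_poly_def
    by (simp add: assoc_mult_mat_vec[symmetric, of _ n n _ n] smult_mat_mult_vec)
  moreover have "adj_mat ?M *\<^sub>v (?M *\<^sub>v w) = ?q \<cdot>\<^sub>v (adj_mat ?M *\<^sub>v w')"
    unfolding Mw using adj_mat(1)[OF M] w' by (intro mult_mat_smult_vec) auto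
  ultimately have eq: "char_poly A \<cdot>\<^sub>v w = ?q \<cdot>\<^sub>v (adj_mat ?M *\<^sub>v w')"
    by simp
  \<comment> \<open>At such a coordinate \<open>w\<close> has an entry of degree 1, which
    \<open>q\<close> cannot divide; as \<open>q\<close> is prime, it divides the other factor
    \<open>char_poly A\<close>.\<close>
  obtain i where i: "i < n" "u $ i \<noteq> 0"
    using u by (metis carrier_vecD eq_vecI index_zero_vec)
  have "?q dvd char_poly A * w $ i"
    using arg_cong[OF eq, of "\<lambda>x. x $ i"] i w adj_mat(1)[OF M] by (simp del: mult_pCons_left)
  moreover have "\<not> ?q dvd w $ i"
    using i by (auto simp: w_def dest!: dvd_imp_degree_le)
  ultimately show ?thesis
    using field_poly_irreducible_imp_prime[OF irr] by (meson prime_elem_dvd_mult_iff)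
qed

section \<open>The matrix of a module homomorphism\<close>

text \<open>The summands of \<open>Phi\<close> occupy disjoint coordinates \<open>i\<close> and
  \<open>k + i\<close>, so \<open>Phi\<close> only rearranges entries: rows select the component of
  the pair, columns select the half of the vector.\<close>

lemma Phi_vec:
  "Phi k x = (vec (2 * k) (\<lambda>j. if j < k then x j $$ (0, 0) else x (j - k) $$ (0, 1)),
              vec (2 * k) (\<lambda>j. if j < k then x j $$ (1, 0) else x (j - k) $$ (1, 1)))"
proof -
  have "finsum_vec TYPE('a) (2 * k) (\<lambda>i. a i \<cdot>\<^sub>v unit_vec (2 * k) i + b i \<cdot>\<^sub>v unit_vec (2 * k) (k + i)) {..<k}
      = vec (2 * k) (\<lambda>j. if j < k then a j else b (j - k))" (is "?L = ?R")
    for a b :: "nat \<Rightarrow> 'a"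
  proof (rule eq_vecI)
    fix j assume "j < dim_vec ?R"
    then have j: "j < 2 * k" by simp
    have "?L $ j = (\<Sum>i<k. (a i \<cdot>\<^sub>v unit_vec (2 * k) i + b i \<cdot>\<^sub>v unit_vec (2 * k) (k + i)) $ j)"
      using j by (intro index_finsum_vec) auto
    also have "\<dots> = (\<Sum>i<k. (if i = j then a i else 0) + (if k \<le> j \<and> i = j - k then b i else 0))"
      using j by (intro sum.cong refl) (auto simp: unit_vec_def)
    also have "\<dots> = ?R $ j"
      using j by (auto simp: sum.distrib)
    finally show "?L $ j = ?R $ j" .
  next
    have "?L \<in> carrier_vec (2 * k)"
      by (intro finsum_vec_closed) auto
    then show "dim_vec ?L = dim_vec ?R"
      by simp
  qed
  then show ?thesis
    by (simp add: Phi_def U_act_def U_basis_def del: One_nat_def)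
qed

lemma Phi_carrier: "Phi k x \<in> U_carrier k"
  by (simp add: Phi_vec U_carrier_def)

lemma Phi_inj: "inj_on (Phi k) (R_pow k :: (nat \<Rightarrow> 'a::field mat) set)"
proof (rule inj_onI)
  fix x y :: "nat \<Rightarrow> 'a mat"
  assume x: "x \<in> R_pow k" and y: "y \<in> R_pow k" and eq: "Phi k x = Phi k y"
  have fst: "(if j < k then x j $$ (0, 0) else x (j - k) $$ (0, 1))
      = (if j < k then y j $$ (0, 0) else y (j - k) $$ (0, 1))" if "j < 2 * k" for j
    using arg_cong[OF eq, of "\<lambda>w. fst w $ j"] that by (simp add: Phi_vec)
  have snd: "(if j < k then x j $$ (1, 0) else x (j - k) $$ (1, 1))
      = (if j < k then y j $$ (1, 0) else y (j - k) $$ (1, 1))" if "j < 2 * k" for j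
    using arg_cong[OF eq, of "\<lambda>w. snd w $ j"] that by (simp add: Phi_vec)
  have "x i = y i" if i: "i < k" for i
  proof (rule eq_matI)
    have xi: "x i \<in> carrier_mat 2 2" and yi: "y i \<in> carrier_mat 2 2"
      using x y i by (auto simp: R_pow_def)
    then show "dim_row (x i) = dim_row (y i)" "dim_col (x i) = dim_col (y i)"
      by auto
    fix r c assume "r < dim_row (y i)" "c < dim_col (y i)"
    then have "r = 0 \<or> r = 1" "c = 0 \<or> c = 1"
      using yi by auto
    then show "x i $$ (r, c) = y i $$ (r, c)"
      using fst[of i] fst[of "k + i"] snd[of i] snd[of "k + i"] i by auto
  qed
  then show "x = y"
    using x y unfolding R_pow_def
    by (intro PiE_ext[of x "{..<k}" "\<lambda>_. carrier_mat 2 2"]) auto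
qed

lemma Phi_bij: "bij_betw (Phi k) (R_pow k) (U_carrier k)"
proof -
  have "w \<in> Phi k ` R_pow k" if w: "w \<in> U_carrier k" for w :: "'a::field vec \<times> 'a vec"
  proof
    \<comment> \<open>The preimage reads the layout of \<open>Phi_vec\<close> backwards.\<close>
    let ?x = "\<lambda>i\<in>{..<k}. mat 2 2 (\<lambda>(r, c). (if r = 0 then fst w else snd w) $ (if c = 0 then i else k + i))"
    show "?x \<in> R_pow k"
      by (auto simp: R_pow_def)
    show "w = Phi k ?x"
      using w by (auto simp: Phi_vec U_carrier_def prod_eq_iff intro!: eq_vecI)
  qed
  then show ?thesis
    using Phi_inj Phi_carrier unfolding bij_betw_def by blast
qed

lemma R_pow_add_closed: "x \<in> R_pow k \<Longrightarrow> y \<in> R_pow k \<Longrightarrow> R_pow_add k x y \<in> R_pow k"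
  unfolding R_pow_def R_pow_add_def restrict_PiE_iff
  by (intro ballI add_carrier_mat) (auto dest: PiE_mem)

lemma R_pow_smult_closed:
  "M \<in> carrier_mat 2 2 \<Longrightarrow> x \<in> R_pow k \<Longrightarrow> R_pow_smult k M x \<in> R_pow k"
  unfolding R_pow_def R_pow_smult_def restrict_PiE_iff
  by (intro ballI mult_carrier_mat[of M 2 2]) (auto dest: PiE_mem)

lemma Phi_add:
  assumes "x \<in> R_pow k" "y \<in> R_pow k"
  shows "Phi k (R_pow_add k x y) = (fst (Phi k x) + fst (Phi k y), snd (Phi k x) + snd (Phi k y))"
proof -
  have add: "(x i + y i) $$ (r, c) = x i $$ (r, c) + y i $$ (r, c)" if "i < k" "r < 2" "c < 2" for i r c
    using assms that by (auto simp: R_pow_def dest!: PiE_mem)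
  have "i - k < k" if "i < 2 * k" "\<not> i < k" for i
    using that by arith
  then show ?thesis
    by (auto simp: Phi_vec R_pow_add_def add simp del: One_nat_def intro!: eq_vecI)
qed

lemma Phi_smult:
  assumes M: "M \<in> carrier_mat 2 2" and x: "x \<in> R_pow k"
  shows "Phi k (R_pow_smult k M x) = U_act M (Phi k x)"
proof -
  have xi: "x i \<in> carrier_mat 2 2" if "i < k" for i
    using x that by (auto simp: R_pow_def)
  have mul: "(M * x i) $$ (r, c) = M $$ (r, 0) * x i $$ (0, c) + M $$ (r, 1) * x i $$ (1, c)"
    if "i < k" "r < 2" "c < 2" for i r c
  proof -
    have "{0..<2} = {0, 1 :: nat}" by auto
    then show ?thesis
      using M xi[OF that(1)] that by (simp add: scalar_prod_def)
  qed
  have "i - k < k" if "i < 2 * k" "\<not> i < k" for i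
    using that by arith
  then show ?thesis
    by (auto simp: Phi_vec R_pow_smult_def U_act_def mul simp del: One_nat_def intro!: eq_vecI)
qed

section \<open>Endomorphisms of the module of pairs as square matrices\<close>

lemma additive_homogeneous_mat:
  fixes h :: "'a::field vec \<Rightarrow> 'a vec"
  assumes closed: "\<And>v. v \<in> carrier_vec n \<Longrightarrow> h v \<in> carrier_vec n"
    and add: "\<And>v w. v \<in> carrier_vec n \<Longrightarrow> w \<in> carrier_vec n \<Longrightarrow> h (v + w) = h v + h w"
    and smult: "\<And>c v. v \<in> carrier_vec n \<Longrightarrow> h (c \<cdot>\<^sub>v v) = c \<cdot>\<^sub>v h v"
  obtains A where "A \<in> carrier_mat n n" "\<And>v. v \<in> carrier_vec n \<Longrightarrow> h v = A *\<^sub>v v"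
proof
  define A where "A = mat n n (\<lambda>(i, j). h (unit_vec n j) $ i)"
  show A: "A \<in> carrier_mat n n"
    by (simp add: A_def)
  have unit: "h (unit_vec n j) = A *\<^sub>v unit_vec n j" if "j < n" for j
    using closed[of "unit_vec n j"] that
    by (auto simp: A_def intro!: eq_vecI)
  \<comment> \<open>Induction on the number \<open>m\<close> of coordinates kept replaces the
    expansion of \<open>v\<close> in the standard basis; each step adds one multiple of a unit
    vector.\<close>
  have trunc: "h (vec n (\<lambda>i. if i < m then v $ i else 0)) = A *\<^sub>v vec n (\<lambda>i. if i < m then v $ i else 0)"
    if "m \<le> n" for m and v :: "'a vec"
    using that
  proof (induction m)
    case 0
    \<comment> \<open>The zero vector as a zero multiple: homogeneity then gives
      \<open>h 0 = 0\<close>.\<close>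
    have "vec n (\<lambda>i. if i < 0 then v $ i else 0) = 0 \<cdot>\<^sub>v (0\<^sub>v n :: 'a vec)"
      by (intro eq_vecI) auto
    then show ?case
      using smult[of "0\<^sub>v n" 0] closed[of "0\<^sub>v n"] A by (auto intro!: eq_vecI)
  next
    case (Suc m)
    let ?t = "\<lambda>m. vec n (\<lambda>i. if i < m then v $ i else 0)"
    have split: "?t (Suc m) = ?t m + v $ m \<cdot>\<^sub>v unit_vec n m"
      using Suc.prems by (intro eq_vecI) (auto simp: less_Suc_eq unit_vec_def)
    show ?case
      unfolding split using Suc A
      by (simp add: add smult unit mult_add_distrib_mat_vec[of _ n n] mult_mat_vec[of _ n n])
  qed
  fix v :: "'a vec" assume "v \<in> carrier_vec n"
  then have "vec n (\<lambda>i. if i < n then v $ i else 0) = v"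
    by (intro eq_vecI) auto
  then show "h v = A *\<^sub>v v"
    using trunc[of n v] by simp
qed

text \<open>An endomorphism commutes with the matrix units, so it acts on both components by the same
  linear map.\<close>

lemma corresponds_to_exists:
  fixes f :: "(nat \<Rightarrow> 'a::field mat) \<Rightarrow> (nat \<Rightarrow> 'a mat)"
  assumes f: "f \<in> R_pow_hom k"
  shows "\<exists>A. corresponds_to k f A"
proof -
  let ?n = "2 * k"
  \<comment> \<open>\<open>g\<close> is \<open>f\<close> transported to pairs along
    \<open>Phi\<close>.\<close>
  define g where "g w = Phi k (f (inv_into (R_pow k) (Phi k) w))" for w
  have g_carrier: "g w \<in> U_carrier k" for w
    by (simp add: g_def Phi_carrier)
  have f_closed: "f x \<in> R_pow k" if "x \<in> R_pow k" for x
    using f that by (auto simp: R_pow_hom_def)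
  have g_Phi: "g (Phi k x) = Phi k (f x)" if "x \<in> R_pow k" for x
    using that by (simp add: g_def inv_into_f_f[OF Phi_inj])
  have surj: "\<exists>x \<in> R_pow k. w = Phi k x" if "w \<in> U_carrier k" for w :: "'a vec \<times> 'a vec"
    using that Phi_bij[of k] unfolding bij_betw_def by blast
  have g_add: "g (fst w + fst z, snd w + snd z) = (fst (g w) + fst (g z), snd (g w) + snd (g z))"
    if wz: "w \<in> U_carrier k" "z \<in> U_carrier k" for w z
  proof -
    obtain x y where xy: "x \<in> R_pow k" "y \<in> R_pow k" "w = Phi k x" "z = Phi k y"
      using wz surj by blast
    have "f (R_pow_add k x y) = R_pow_add k (f x) (f y)"
      using f xy by (auto simp: R_pow_hom_def)
    then show ?thesis
      using xy g_Phi[of "R_pow_add k x y"] by (simp add: Phi_add R_pow_add_closed f_closed g_Phi)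
  qed
  have g_act: "g (U_act M w) = U_act M (g w)" if M: "M \<in> carrier_mat 2 2" and w: "w \<in> U_carrier k" for M w
  proof -
    obtain x where x: "x \<in> R_pow k" "w = Phi k x"
      using w surj by blast
    have "f (R_pow_smult k M x) = R_pow_smult k M (f x)"
      using f x M by (auto simp: R_pow_hom_def)
    then show ?thesis
      using M x g_Phi[of "R_pow_smult k M x"] by (simp add: Phi_smult R_pow_smult_closed f_closed g_Phi)
  qed
  define h where "h u = fst (g (u, 0\<^sub>v ?n))" for u
  \<comment> \<open>A multiple of the matrix unit at \<open>(r, 0)\<close> moves the scaled first
    component into component \<open>r\<close> and erases the rest.\<close>
  have act: "U_act (mat 2 2 (\<lambda>(i, j). if (i, j) = (r, 0) then c else 0)) w =
      (if r = 0 then (c \<cdot>\<^sub>v fst w, 0\<^sub>v ?n) else (0\<^sub>v ?n, c \<cdot>\<^sub>v fst w))"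
    if "r < 2" "w \<in> U_carrier k" for c r and w :: "'a vec \<times> 'a vec"
    using that by (auto simp: U_act_def U_carrier_def intro!: eq_vecI)
  \<comment> \<open>The unit at \<open>(0, 0)\<close> keeps the image in the first component; the
    factor \<open>c\<close> yields homogeneity of \<open>h\<close>.\<close>
  have left: "g (c \<cdot>\<^sub>v u, 0\<^sub>v ?n) = (c \<cdot>\<^sub>v h u, 0\<^sub>v ?n)" if "u \<in> carrier_vec ?n" for c u
    using g_act[of "mat 2 2 (\<lambda>(i, j). if (i, j) = (0, 0) then c else 0)" "(u, 0\<^sub>v ?n)"]
      act[of 0 "(u, 0\<^sub>v ?n)" c] act[of 0 "g (u, 0\<^sub>v ?n)" c] that g_carrier
    by (simp add: h_def U_carrier_def)
  \<comment> \<open>The unit at \<open>(1, 0)\<close> carries \<open>(u, 0)\<close> to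
    \<open>(0, u)\<close>, which forces the same \<open>h\<close> on the second component.\<close>
  have right: "g (0\<^sub>v ?n, u) = (0\<^sub>v ?n, h u)" if "u \<in> carrier_vec ?n" for u
    using g_act[of "mat 2 2 (\<lambda>(i, j). if (i, j) = (1, 0) then 1 else 0)" "(u, 0\<^sub>v ?n)"]
      act[of 1 "(u, 0\<^sub>v ?n)" 1] act[of 1 "g (u, 0\<^sub>v ?n)" 1] that g_carrier
    by (simp add: h_def U_carrier_def)
  have h_carrier: "h u \<in> carrier_vec ?n" for u
    using g_carrier[of "(u, 0\<^sub>v ?n)"] by (auto simp: h_def U_carrier_def)
  have left1: "g (u, 0\<^sub>v ?n) = (h u, 0\<^sub>v ?n)" if "u \<in> carrier_vec ?n" for u
    using left[OF that, of 1] by simp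
  obtain A where A: "A \<in> carrier_mat ?n ?n" "\<And>v. v \<in> carrier_vec ?n \<Longrightarrow> h v = A *\<^sub>v v"
  proof (rule additive_homogeneous_mat[of ?n h])
    show "h (v + w) = h v + h w" if "v \<in> carrier_vec ?n" "w \<in> carrier_vec ?n" for v w
      using g_add[of "(v, 0\<^sub>v ?n)" "(w, 0\<^sub>v ?n)"] that by (simp add: U_carrier_def h_def)
    show "h (c \<cdot>\<^sub>v v) = c \<cdot>\<^sub>v h v" if "v \<in> carrier_vec ?n" for c v
      using left[OF that, of c] by (simp add: h_def)
  qed (use h_carrier in auto)
  have "g w = U_endo A w" if w: "w \<in> U_carrier k" for w
  proof -
    have c: "fst w \<in> carrier_vec ?n" "snd w \<in> carrier_vec ?n"
      using w by (auto simp: U_carrier_def)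
    have "g (fst w, snd w) = (h (fst w), h (snd w))"
      using g_add[of "(fst w, 0\<^sub>v ?n)" "(0\<^sub>v ?n, snd w)"] c h_carrier[of "fst w"] h_carrier[of "snd w"]
      by (simp add: U_carrier_def left1 right)
    then show ?thesis
      using A c by (simp add: U_endo_def)
  qed
  then show ?thesis
    using A unfolding corresponds_to_def g_def by blast
qed

lemma corresponds_to_unique:
  assumes "corresponds_to k f A" "corresponds_to k f B"
  shows "A = B"
proof (rule eq_matI)
  have A: "A \<in> carrier_mat (2 * k) (2 * k)" and B: "B \<in> carrier_mat (2 * k) (2 * k)"
    using assms by (auto simp: corresponds_to_def)
  then show "dim_row A = dim_row B" "dim_col A = dim_col B"
    by auto
  fix i j assume ij: "i < dim_row B" "j < dim_col B"
  \<comment> \<open>The pair with \<open>j\<close>-th unit vector and zero vector detects column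
    \<open>j\<close>.\<close>
  have "U_endo A (unit_vec (2 * k) j, 0\<^sub>v (2 * k)) = U_endo B (unit_vec (2 * k) j, 0\<^sub>v (2 * k))"
    using assms unfolding corresponds_to_def by (metis U_carrier_def SigmaI unit_vec_carrier zero_carrier_vec)
  then have "(A *\<^sub>v unit_vec (2 * k) j) $ i = (B *\<^sub>v unit_vec (2 * k) j) $ i"
    by (simp add: U_endo_def)
  then show "A $$ (i, j) = B $$ (i, j)"
    using A B ij by simp
qed

lemma hom_mat_carrier:
  assumes "f \<in> R_pow_hom k"
  shows "hom_mat k f \<in> carrier_mat (2 * k) (2 * k)"
proof -
  obtain A where A: "corresponds_to k f A"
    using corresponds_to_exists[OF assms] ..
  then have "hom_mat k f = A"
    unfolding hom_mat_def using corresponds_to_unique by (intro the_equality)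
  then show ?thesis
    using A by (simp add: corresponds_to_def)
qed

section \<open>Matrices of size two\<close>

lemma mat_of_rows_list_2_carrier: "mat_of_rows_list 2 [[a, b], [c, d]] \<in> carrier_mat 2 2"
  by (intro carrier_matI) (auto simp: mat_of_rows_list_def)

lemma mat_of_rows_list_2_index:
  "mat_of_rows_list 2 [[a, b], [c, d]] $$ (0, 0) = a" "mat_of_rows_list 2 [[a, b], [c, d]] $$ (0, 1) = b"
  "mat_of_rows_list 2 [[a, b], [c, d]] $$ (1, 0) = c" "mat_of_rows_list 2 [[a, b], [c, d]] $$ (1, 1) = d"
  by (simp_all add: mat_of_rows_list_def)

lemma eq_mat_2I:
  assumes "A \<in> carrier_mat 2 2" "B \<in> carrier_mat 2 2"
    and "A $$ (0, 0) = B $$ (0, 0)" "A $$ (0, 1) = B $$ (0, 1)"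
    and "A $$ (1, 0) = B $$ (1, 0)" "A $$ (1, 1) = B $$ (1, 1)"
  shows "A = B"
  using assms by (intro eq_matI) (auto simp: less_2_cases_iff)

lemma mat_of_rows_list_2_mult:
  fixes a b c d :: "'a::semiring_0"
  shows "mat_of_rows_list 2 [[a, b], [c, d]] * mat_of_rows_list 2 [[a', b'], [c', d']] =
    mat_of_rows_list 2 [[a * a' + b * c', a * b' + b * d'], [c * a' + d * c', c * b' + d * d']]"
  by (intro eq_mat_2I mult_carrier_mat[of _ 2 2] mat_of_rows_list_2_carrier)
    (simp_all add: mat_of_rows_list_def scalar_prod_def numeral_2_eq_2)

lemma det_2:
  assumes A: "A \<in> carrier_mat 2 2"
  shows "det A = A $$ (0, 0) * A $$ (1, 1) - A $$ (1, 0) * A $$ (0, 1)"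
proof -
  have "{..<2} = {0, 1 :: nat}" by auto
  then show ?thesis
    using A laplace_expansion_column[OF A, of 0]
    by (simp add: cofactor_def det_single mat_delete_def)
qed

text \<open>Recovers the quadratic from its companion matrix, so distinct quadratics give
  non-similar matrices.\<close>

lemma char_poly_companion:
  "char_poly (mat_of_rows_list 2 [[- l, 1], [- m, 0]]) = [:m, l, 1:]"
  unfolding char_poly_def
  by (subst det_2) (auto simp: char_poly_matrix_def mat_of_rows_list_def)

text \<open>Left eigenvectors are the relevant ones: on a plane spanned by \<open>u\<close> and
  \<open>v\<close>, the coordinate row \<open>(a, b)\<close> is multiplied by the super-eigenvalue
  from the right.\<close>

lemma left_eigenvector_2:
  fixes p q r s c :: "'a::field"
  assumes "c\<^sup>2 - (p + s) * c + (p * s - q * r) = 0"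
  obtains a b where "(a, b) \<noteq> (0, 0)" "a * p + b * r = c * a" "a * q + b * s = c * b"
proof -
  have eq: "(c - p) * (c - s) = q * r"
    using assms by (simp add: algebra_simps power2_eq_square)
  \<comment> \<open>The first two cases use the displayed pair as eigenvector; if both pairs vanish,
    the matrix is the scalar \<open>c\<close> and any nonzero row works.\<close>
  consider "(r, c - p) \<noteq> (0, 0)" | "r = 0" "c = p" "(c - s, q) \<noteq> (0, 0)" | "r = 0" "c = p" "c = s" "q = 0"
    by auto
  then show ?thesis
  proof cases
    case 1
    moreover have "r * p + (c - p) * r = c * r"
      by (simp add: algebra_simps)
    moreover have "r * q + (c - p) * s = c * (c - p)"
      using eq by (simp add: algebra_simps)
    ultimately show ?thesis
      using that by blast
  next
    case 2
    moreover from this have "(c - s) * p + q * r = c * (c - s)" "(c - s) * q + q * s = c * q"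
      by (simp_all add: algebra_simps)
    ultimately show ?thesis
      using that by blast
  next
    case 3
    then show ?thesis
      using that[of 1 0] by auto
  qed
qed

lemma similar_companion:
  fixes p q r s :: "'a::field"
  assumes "q \<noteq> 0"
  shows "similar_mat (mat_of_rows_list 2 [[p, q], [r, s]])
    (mat_of_rows_list 2 [[p + s, 1], [- (p * s - q * r), 0]])"
proof (rule similar_matI)
  \<comment> \<open>The rows of \<open>?Q\<close> are the coordinates of \<open>u\<close> and
    \<open>A u - (p + s) u = q v - s u\<close>, the basis in which the action is the companion
    matrix; \<open>q \<noteq> 0\<close> makes it a basis.\<close>
  let ?P = "mat_of_rows_list 2 [[1, 0], [s / q, 1 / q]]" and ?Q = "mat_of_rows_list 2 [[1, 0], [- s, q]]"
  have one: "1\<^sub>m 2 = mat_of_rows_list 2 [[1, 0], [0, 1 :: 'a]]"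
    by (intro eq_mat_2I) (auto simp: mat_of_rows_list_def)
  show "?P * ?Q = 1\<^sub>m 2" "?Q * ?P = 1\<^sub>m 2"
    using assms by (simp_all add: one mat_of_rows_list_2_mult)
  show "mat_of_rows_list 2 [[p, q], [r, s]] = ?P * mat_of_rows_list 2 [[p + s, 1], [- (p * s - q * r), 0]] * ?Q"
  proof -
    have "(1 * (p + s) + 0 * - (p * s - q * r)) * 1 + (1 * 1 + 0 * 0) * - s = p"
      "(1 * (p + s) + 0 * - (p * s - q * r)) * 0 + (1 * 1 + 0 * 0) * q = q"
      "(s / q * (p + s) + 1 / q * - (p * s - q * r)) * 1 + (s / q * 1 + 1 / q * 0) * - s = r"
      "(s / q * (p + s) + 1 / q * - (p * s - q * r)) * 0 + (s / q * 1 + 1 / q * 0) * q = s"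
      using assms by (simp_all add: field_simps)
    then show ?thesis
      by (simp only: mat_of_rows_list_2_mult)
  qed
qed (auto simp: mat_of_rows_list_2_carrier)

section \<open>Proper super-eigenvalues\<close>

lemma companion_proper_super_eigenvalue:
  fixes A :: "'a::field mat"
  assumes A: "A \<in> carrier_mat n n" and irr: "irreducible [:m, l, 1:]"
    and dvd: "[:m, l, 1:] dvd char_poly A"
  shows "proper_super_eigenvalue A (mat_of_rows_list 2 [[- l, 1], [- m, 0]])"
proof -
  interpret vec_space "TYPE('a)" n .
  have dim: "dim_row A = n"
    using A by auto
  have noroot: "c\<^sup>2 + l * c + m \<noteq> 0" for c
    using irr[unfolded irreducible_monic_quadratic_iff, rule_format, of c]
    by (simp add: algebra_simps power2_eq_square)
  obtain u where u: "u \<in> carrier_vec n" "u \<noteq> 0\<^sub>v n"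
    and ker: "A *\<^sub>v (A *\<^sub>v u) + l \<cdot>\<^sub>v (A *\<^sub>v u) + m \<cdot>\<^sub>v u = 0\<^sub>v n"
    using quadratic_dvd_char_poly_imp_kernel[OF A dvd] .
  \<comment> \<open>With this \<open>v\<close>, the relation \<open>q(A) u = 0\<close> becomes
    \<open>A v = - m u\<close>, the second row of the companion matrix.\<close>
  define v where "v = A *\<^sub>v u + l \<cdot>\<^sub>v u"
  have Au_carrier: "A *\<^sub>v u \<in> carrier_vec n"
    using A u by simp
  then have v: "v \<in> carrier_vec n"
    using u by (simp add: v_def)
  have Au: "A *\<^sub>v u = (- l) \<cdot>\<^sub>v u + 1 \<cdot>\<^sub>v v"
    using Au_carrier u dim unfolding v_def by (intro eq_vecI) auto
  have "A *\<^sub>v v = A *\<^sub>v (A *\<^sub>v u) + l \<cdot>\<^sub>v (A *\<^sub>v u)"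
    using A u Au_carrier unfolding v_def
    by (simp add: mult_add_distrib_mat_vec[of _ n n] mult_mat_smult_vec)
  also have "\<dots> = (- m) \<cdot>\<^sub>v u + 0 \<cdot>\<^sub>v v"
  proof (rule eq_vecI)
    fix i assume "i < dim_vec ((- m) \<cdot>\<^sub>v u + 0 \<cdot>\<^sub>v v)"
    then have i: "i < n" using v by simp
    then show "(A *\<^sub>v (A *\<^sub>v u) + l \<cdot>\<^sub>v (A *\<^sub>v u)) $ i = ((- m) \<cdot>\<^sub>v u + 0 \<cdot>\<^sub>v v) $ i"
      using arg_cong[OF ker, of "\<lambda>x. x $ i"] u v dim
      by (simp del: index_mult_mat_vec add: eq_neg_iff_add_eq_0)
  qed (use u v dim in auto)
  finally have Av: "A *\<^sub>v v = (- m) \<cdot>\<^sub>v u + 0 \<cdot>\<^sub>v v" .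
  have Aw: "A *\<^sub>v (a \<cdot>\<^sub>v u + b \<cdot>\<^sub>v v) = (- (a * l) - b * m) \<cdot>\<^sub>v u + a \<cdot>\<^sub>v v" for a b
  proof -
    have "A *\<^sub>v (a \<cdot>\<^sub>v u + b \<cdot>\<^sub>v v) = a \<cdot>\<^sub>v (A *\<^sub>v u) + b \<cdot>\<^sub>v (A *\<^sub>v v)"
      using A u v by (simp add: mult_add_distrib_mat_vec[of _ n n] mult_mat_smult_vec)
    also have "\<dots> = (- (a * l) - b * m) \<cdot>\<^sub>v u + a \<cdot>\<^sub>v v"
      unfolding Au Av using u v by (intro eq_vecI) (auto simp: algebra_simps)
    finally show ?thesis .
  qed
  have indep: "a = 0 \<and> b = 0" if ab: "a \<cdot>\<^sub>v u + b \<cdot>\<^sub>v v = 0\<^sub>v n" for a b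
  proof -
    obtain i where i: "i < n" "u $ i \<noteq> 0"
      using u by (metis carrier_vecD eq_vecI index_zero_vec)
    have "A *\<^sub>v 0\<^sub>v n = 0\<^sub>v n"
      using A by (intro eq_vecI) auto
    then have ab': "(- (a * l) - b * m) \<cdot>\<^sub>v u + a \<cdot>\<^sub>v v = 0\<^sub>v n"
      using Aw[of a b] ab by simp
    have 1: "a * u $ i + b * v $ i = 0"
      using arg_cong[OF ab, of "\<lambda>x. x $ i"] i u v by simp
    have 2: "(- (a * l) - b * m) * u $ i + a * v $ i = 0"
      using arg_cong[OF ab', of "\<lambda>x. x $ i"] i u v by simp
    \<comment> \<open>Eliminating \<open>v $ i\<close> from the relation and its image under
      \<open>A\<close> leaves the quadratic form obtained by homogenizing \<open>q\<close>.\<close>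
    have "(a\<^sup>2 + l * a * b + m * b\<^sup>2) * u $ i
        = a * (a * u $ i + b * v $ i) - b * ((- (a * l) - b * m) * u $ i + a * v $ i)"
      by (simp add: algebra_simps power2_eq_square)
    also have "\<dots> = 0"
      using 1 2 by simp
    finally have norm: "a\<^sup>2 + l * a * b + m * b\<^sup>2 = 0"
      using i by simp
    have "b = 0"
    \<comment> \<open>Otherwise \<open>a / b\<close> would be a root of \<open>q\<close>.\<close>
    proof (rule ccontr)
      assume "b \<noteq> 0"
      then have "(a / b)\<^sup>2 + l * (a / b) + m = (a\<^sup>2 + l * a * b + m * b\<^sup>2) / b\<^sup>2"
        by (simp add: field_simps power2_eq_square)
      then show False
        using norm noroot[of "a / b"] by simp
    qed
    then show ?thesis
      using norm by simp
  qed
  let ?W = "span {u, v}"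
  note W = pair_basisI[OF u(1) v indep]
  note WD = pair_basisD[OF W(2) W(1) W(3)]
  have invariant: "A *\<^sub>v w \<in> ?W" if "w \<in> ?W" for w
    using span_pair[OF u(1) v W(1) that] Aw WD(4) by metis
  have no_eigenvector: False if w: "w \<in> ?W" and ev: "eigenvector A w c" for w c
  proof -
    obtain a b where w_eq: "w = a \<cdot>\<^sub>v u + b \<cdot>\<^sub>v v"
      using span_pair[OF u(1) v W(1) w] .
    have "A *\<^sub>v w = c \<cdot>\<^sub>v w"
      using ev unfolding eigenvector_def by blast
    then have eq: "(- (a * l) - b * m) \<cdot>\<^sub>v u + a \<cdot>\<^sub>v v = c \<cdot>\<^sub>v (a \<cdot>\<^sub>v u + b \<cdot>\<^sub>v v)"
      unfolding w_eq Aw .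
    have "(- (a * l) - b * m - c * a) \<cdot>\<^sub>v u + (a - c * b) \<cdot>\<^sub>v v = 0\<^sub>v n"
    proof (rule eq_vecI)
      fix i assume "i < dim_vec (0\<^sub>v n :: 'a vec)"
      then show "((- (a * l) - b * m - c * a) \<cdot>\<^sub>v u + (a - c * b) \<cdot>\<^sub>v v) $ i = 0\<^sub>v n $ i"
        using arg_cong[OF eq, of "\<lambda>x. x $ i"] u v by (simp add: algebra_simps)
    qed (use v in simp)
    then have ab: "- (a * l) - b * m - c * a = 0" "a - c * b = 0"
      by (blast dest: indep)+
    \<comment> \<open>Substituting \<open>a = c * b\<close> into the other coordinate equation
      produces \<open>b\<close> times the value of \<open>q\<close> at \<open>c\<close>.\<close>
    have "b * (c\<^sup>2 + l * c + m) = - (- (a * l) - b * m - c * a) - (l + c) * (a - c * b)"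
      by (simp add: algebra_simps power2_eq_square)
    then have "a = 0" "b = 0"
      using ab noroot[of c] by auto
    then show False
      using ev u v w_eq dim unfolding eigenvector_def by auto
  qed
  have "super_eigenvector A ?W"
    unfolding super_eigenvector_def dim using W invariant by auto
  moreover have "super_eigenvalue_of A ?W (mat_of_rows_list 2 [[- l, 1], [- m, 0]])"
    unfolding super_eigenvalue_of_def mat_of_rows_list_2_index dim
    by (intro conjI exI[of _ u] exI[of _ v] calculation mat_of_rows_list_2_carrier W(1,3) Au Av)
  ultimately show ?thesis
    unfolding proper_super_eigenvalue_def proper_super_eigenvector_def using no_eigenvector by blast
qed

lemma proper_super_eigenvalue_similar_companion:
  fixes A :: "'a::field mat"
  assumes A: "A \<in> carrier_mat n n" and L: "proper_super_eigenvalue A L"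
  obtains l m where "irreducible [:m, l, 1:]" "[:m, l, 1:] dvd char_poly A"
    "similar_mat L (mat_of_rows_list 2 [[- l, 1], [- m, 0]])"
proof -
  interpret vec_space "TYPE('a)" n .
  have dim: "dim_row A = n"
    using A by auto
  obtain W u v where sub: "subspace class_ring W V"
    and no_eigenvector: "\<And>w c. w \<in> W \<Longrightarrow> \<not> eigenvector A w c"
    and L_carrier: "L \<in> carrier_mat 2 2" and ne: "u \<noteq> v"
    and basis: "vectorspace.basis class_ring (vs W) {u, v}"
    and Au: "A *\<^sub>v u = L $$ (0,0) \<cdot>\<^sub>v u + L $$ (0,1) \<cdot>\<^sub>v v"
    and Av: "A *\<^sub>v v = L $$ (1,0) \<cdot>\<^sub>v u + L $$ (1,1) \<cdot>\<^sub>v v"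
    using L unfolding proper_super_eigenvalue_def proper_super_eigenvector_def super_eigenvector_def
      super_eigenvalue_of_def dim by blast
  define p q r s where "p = L $$ (0,0)" "q = L $$ (0,1)" "r = L $$ (1,0)" "s = L $$ (1,1)"
  note Au = Au[folded p_q_r_s_def] and Av = Av[folded p_q_r_s_def]
  note WD = pair_basisD[OF sub ne basis]
  have u: "u \<in> carrier_vec n" and v: "v \<in> carrier_vec n"
    using WD by auto
  have A_lin: "A *\<^sub>v (a \<cdot>\<^sub>v u + b \<cdot>\<^sub>v v) = a \<cdot>\<^sub>v (A *\<^sub>v u) + b \<cdot>\<^sub>v (A *\<^sub>v v)" for a b
    using A u v by (simp add: mult_add_distrib_mat_vec[of _ n n] mult_mat_smult_vec)
  have Aw: "A *\<^sub>v (a \<cdot>\<^sub>v u + b \<cdot>\<^sub>v v) = (a * p + b * r) \<cdot>\<^sub>v u + (a * q + b * s) \<cdot>\<^sub>v v" for a b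
    unfolding A_lin unfolding Au Av using u v by (intro eq_vecI) (auto simp: algebra_simps)
  \<comment> \<open>Coefficients of the characteristic polynomial of \<open>L\<close>.\<close>
  define l m where "l = - (p + s)" "m = p * s - q * r"
  \<comment> \<open>A root would give a left eigenvector of \<open>L\<close>, hence an eigenvector
    of \<open>A\<close> in \<open>W\<close>.\<close>
  have noroot: "c\<^sup>2 - (p + s) * c + (p * s - q * r) \<noteq> 0" for c
  proof
    assume "c\<^sup>2 - (p + s) * c + (p * s - q * r) = 0"
    then obtain a b where ab: "(a, b) \<noteq> (0, 0)" "a * p + b * r = c * a" "a * q + b * s = c * b"
      by (rule left_eigenvector_2)
    let ?w = "a \<cdot>\<^sub>v u + b \<cdot>\<^sub>v v"
    have "A *\<^sub>v ?w = c \<cdot>\<^sub>v ?w"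
      unfolding Aw ab(2,3) using u v by (intro eq_vecI) (auto simp: algebra_simps)
    moreover have "?w \<noteq> 0\<^sub>v n"
      using WD(5)[of a b] ab(1) by auto
    ultimately have "eigenvector A ?w c"
      unfolding eigenvector_def dim using u v by auto
    then show False
      using no_eigenvector WD(4) by blast
  qed
  \<comment> \<open>For \<open>q = 0\<close> the entry \<open>p\<close> would be a root.\<close>
  have q: "q \<noteq> 0"
    using noroot[of p] by (auto simp: algebra_simps power2_eq_square)
  have irr: "irreducible [:m, l, 1:]"
    unfolding irreducible_monic_quadratic_iff
    using noroot by (simp add: l_m_def algebra_simps power2_eq_square)
  \<comment> \<open>The Cayley-Hamilton identity of \<open>L\<close>, evaluated at
    \<open>u\<close>.\<close>
  have ker: "A *\<^sub>v (A *\<^sub>v u) + l \<cdot>\<^sub>v (A *\<^sub>v u) + m \<cdot>\<^sub>v u = 0\<^sub>v n"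
    unfolding Au Aw l_m_def using u v by (intro eq_vecI) (auto simp: algebra_simps)
  have "u \<noteq> 0\<^sub>v n"
    using WD(5)[of 1 0] u v by auto
  then have dvd: "[:m, l, 1:] dvd char_poly A"
    using irreducible_quadratic_kernel_imp_dvd_char_poly[OF A u _ ker irr] by blast
  have "L = mat_of_rows_list 2 [[p, q], [r, s]]"
    using L_carrier mat_of_rows_list_2_carrier
    by (intro eq_mat_2I) (simp_all only: mat_of_rows_list_2_index p_q_r_s_def)
  then have "similar_mat L (mat_of_rows_list 2 [[- l, 1], [- m, 0]])"
    using similar_companion[OF q, of p r s] by (simp add: l_m_def add.commute)
  then show ?thesis
    using that irr dvd by blast
qed

section \<open>Transfer from the matrix \<open>A\<close> to the homomorphism
  \<open>f\<close>\<close>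

theorem corollary3p6:
  fixes f :: "(nat \<Rightarrow> 'a::field mat) \<Rightarrow> (nat \<Rightarrow> 'a mat)"
    and A :: "'a mat"
    and p :: "nat \<Rightarrow> 'a poly"
    and lam mu :: "nat \<Rightarrow> 'a"
    and \<Lambda> :: "nat \<Rightarrow> 'a mat"
    and k m :: nat
  assumes "CHAR('a) \<noteq> 2"
    and "k \<ge> 1"
    and "f \<in> R_pow_hom k"
    and "A = hom_mat k f"
    and "bij_betw p {1..m}
           {q. lead_coeff q = 1 \<and> degree q = 2 \<and> irreducible q \<and> q dvd char_poly A}"
    and "\<And>i. i \<in> {1..m} \<Longrightarrow> p i = [:mu i, lam i, 1:]"
    and "\<And>i. i \<in> {1..m} \<Longrightarrow> \<Lambda> i = mat_of_rows_list 2 [[- lam i, 1], [- mu i, 0]]"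
  shows "(\<forall>i\<in>{1..m}. proper_eigenvalue k f (\<Lambda> i)) \<and>
         (\<forall>i\<in>{1..m}. \<forall>j\<in>{1..m}. i \<noteq> j \<longrightarrow> \<not> similar_mat (\<Lambda> i) (\<Lambda> j)) \<and>
         (\<forall>L. proper_eigenvalue k f L \<longrightarrow> (\<exists>i\<in>{1..m}. similar_mat L (\<Lambda> i)))"
proof (intro conjI ballI allI impI)
  note p_eq = assms(6) and Lambda_eq = assms(7)
  have A: "A \<in> carrier_mat (2 * k) (2 * k)"
    unfolding assms(4) using assms(3) by (rule hom_mat_carrier)
  {
    fix i assume i: "i \<in> {1..m}"
    then have "p i \<in> {q. lead_coeff q = 1 \<and> degree q = 2 \<and> irreducible q \<and> q dvd char_poly A}"
      by (rule bij_betw_apply[OF assms(5)])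
    then show "proper_eigenvalue k f (\<Lambda> i)"
      using companion_proper_super_eigenvalue[OF A, of "mu i" "lam i"] i
      by (simp add: proper_eigenvalue_def assms(4) p_eq Lambda_eq)
  next
    fix i j assume ij: "i \<in> {1..m}" "j \<in> {1..m}" "i \<noteq> j"
    show "\<not> similar_mat (\<Lambda> i) (\<Lambda> j)"
    proof
      assume "similar_mat (\<Lambda> i) (\<Lambda> j)"
      \<comment> \<open>Similar matrices share their characteristic polynomial, here
        \<open>p i\<close> and \<open>p j\<close>; injectivity of \<open>p\<close> then contradicts
        \<open>i \<noteq> j\<close>.\<close>
      then have "p i = p j"
        using char_poly_similar[of "\<Lambda> i" "\<Lambda> j"] ij
        by (simp add: p_eq Lambda_eq char_poly_companion del: pCons_eq_iff)
      then show False
        using ij inj_onD[OF bij_betw_imp_inj_on[OF assms(5)]] by blast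
    qed
  next
    fix L assume "proper_eigenvalue k f L"
    then have "proper_super_eigenvalue A L"
      by (simp add: proper_eigenvalue_def assms(4))
    then obtain l n where ln: "irreducible [:n, l, 1:]" "[:n, l, 1:] dvd char_poly A"
      "similar_mat L (mat_of_rows_list 2 [[- l, 1], [- n, 0]])"
      using proper_super_eigenvalue_similar_companion[OF A] by blast
    \<comment> \<open>The polynomial belongs to the set enumerated by \<open>p\<close>; comparing
      coefficients identifies its companion matrix with some \<open>\<Lambda> i\<close>.\<close>
    then have "[:n, l, 1:] \<in> p ` {1..m}"
      using assms(5) unfolding bij_betw_def by simp
    then obtain i where "i \<in> {1..m}" "[:n, l, 1:] = [:mu i, lam i, 1:]"
      using p_eq by auto
    then show "\<exists>i\<in>{1..m}. similar_mat L (\<Lambda> i)"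
      using ln(3) Lambda_eq by auto
  }
qed

end
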